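(* Let $S_1=\{0,1\}^P$, let $S_2,S_3\subset S_1$ with $|S_2|=|S_3|$, and let $\phi:S_2\to S_3$ be a bijection with $\phi(x)=x$ for all $x\in S_2\cap S_3$. Put $S_2'=S_2\setminus S_3$ and $S_3'=S_3\setminus S_2$. For each $a\in S_2'$ let a shortest Hamming path $\mathcal P_a$ from $a$ to $\phi(a)$ be chosen, avoiding $S_2\cap S_3$, with corresponding local walk operator $\mathcal W_a$ (see context). Suppose that the selected paths admit an admissible routing schedule $(a_1,\dots,a_r)$, $r=|S_2'|$ (see context), and let $\mathrm{A\_PERMUTE}=\mathcal W_{a_r}\cdots\mathcal W_{a_2}\mathcal W_{a_1}$. Then $\mathrm{A\_PERMUTE}$ is a permutation unitary, i.e. there is a permutation $\sigma:S_1\to S_1$ with $\mathrm{A\_PERMUTE}\,|x\rangle=|\sigma(x)\rangle$ for all $x\in S_1$, and $$\sigma(a)=\phi(a)\quad\text{for all } a\in S_2 .$$ Consequently, $$\sigma(S_2)=S_3,\qquad \sigma(S_1\setminus S_2)=S_1\setminus S_3 .$$ In general (that is, not in every instance is it the identity), the restriction of $\sigma$ to $S_1\setminus S_2$ is a nontrivial map, the complementary permutation induced by the same network of $\mathrm{A\_SWAP}$ operations.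
   Context: The Hilbert space is that of $P$ qubits indexed by $G=\{0,\dots,P-1\}$, with computational basis $\{|x\rangle:x\in\{0,1\}^P\}$. $D_H$ denotes Hamming distance. $\mathrm{A\_SWAP}(a,b)$: for $a,b\in\{0,1\}^P$ differing exactly at one index $t\in G$, with common values $c=(c_i)_{i\in G\setminus\{t\}}$, $c_i=a_i=b_i$, $\mathrm{A\_SWAP}(a,b)$ is the multi-controlled NOT gate flipping qubit $t$ exactly when the qubits in $G\setminus\{t\}$ are in state $c$. It exchanges $|a\rangle$ and $|b\rangle$ and fixes every other computational basis state. Paths: under the hypotheses on $\phi$, it restricts to a bijection $S_2'\to S_3'$. For $a\in S_2'$, a selected path is a sequence $\mathcal P_a: a=a^{(0)}\to a^{(1)}\to\cdots\to a^{(m_a)}=\phi(a)$ in $\{0,1\}^P$ with $m_a=D_H(a,\phi(a))$, $D_H(a^{(k)},a^{(k+1)})=1$, and $a^{(k)}\notin S_2\cap S_3$ for $k=0,\dots,m_a-1$. Its intermediate vertices are $a^{(1)},\dots,a^{(m_a-1)}$. Local walk operator: $\mathcal W_a=\prod_{k=0}^{m_a-1}\mathrm{A\_SWAP}(a^{(k)},a^{(k+1)})$, with the product ordered along the path, i.e. $\mathrm{A\_SWAP}(a^{(0)},a^{(1)})$ is applied first and $\mathrm{A\_SWAP}(a^{(m_a-1)},a^{(m_a)})$ last. It thus cyclically permutes the basis states on the path, sending $|a\rangle$ to $|\phi(a)\rangle$. Admissible routing schedule: an ordering $a_1,\dots,a_r$ of the elements of $S_2'$ (the walks $\mathcal W_{a_1},\dots,\mathcal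 W_{a_r}$ being applied in this order) such that: 1. each local walk is executed completely before the next begins; 2. a source state in $S_2'$ may be used as an intermediate vertex only after its assigned amplitude has reached its destination: if $a_\ell$ is an intermediate vertex of $\mathcal P_{a_q}$, then $\ell<q$; 3. a target state in $S_3'$ may be used as an intermediate vertex only before its assigned amplitude arrives: if $\phi(a_\ell)$ is an intermediate vertex of $\mathcal P_{a_q}$, then $q<\ell$; 4. intermediate states outside $S_2\cup S_3$ may be reused arbitrarily; 5. distinct paths may intersect and share intermediate states; no disjointness is required as long as 1–4 hold. *)

theory Defs
  imports "HOL-Analysis.Analysis"
begin

text \<open>The qubits are indexed by a finite type \<open>'g\<close>, so \<open>P = CARD('g)\<close>, and \<open>{0,1}^P\<close> is the
  whole type \<open>'g \<Rightarrow> bool\<close>. Since that type is finite, it indexes the coordinates of the Hilbert space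
  and the rows and columns of operators.\<close>

type_synonym 'g bits = "'g \<Rightarrow> bool"
type_synonym 'g state = "complex ^ ('g bits)"
type_synonym 'g operator = "complex ^ ('g bits) ^ ('g bits)"

definition hamming :: "'g::finite bits \<Rightarrow> 'g bits \<Rightarrow> nat" where
  "hamming x y = card {i. x i \<noteq> y i}"

definition ket :: "'g::finite bits \<Rightarrow> 'g state" where
  "ket x = axis x 1"

text \<open>The control pattern \<open>c\<close> is read only on the qubits other than the target \<open>t\<close>.\<close>

definition mcx_bits :: "'g \<Rightarrow> 'g bits \<Rightarrow> 'g bits \<Rightarrow> 'g bits" where
  "mcx_bits t c x = (if \<forall>i. i \<noteq> t \<longrightarrow> x i = c i then x(t := \<not> x t) else x)"

definition mcx :: "'g::finite \<Rightarrow> 'g bits \<Rightarrow> 'g operator" where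
  "mcx t c = (\<chi> y x. if y = mcx_bits t c x then 1 else 0)"

text \<open>Meaningful only when \<open>a\<close> and \<open>b\<close> differ at exactly one index.\<close>

definition A_SWAP :: "'g::finite bits \<Rightarrow> 'g bits \<Rightarrow> 'g operator" where
  "A_SWAP a b = mcx (THE t. a t \<noteq> b t) a"

lemma A_SWAP_ket:
  assumes "hamming a b = 1"
  shows "A_SWAP a b *v ket x = ket (if x = a then b else if x = b then a else x)"
proof -
  obtain t where t: "{i. a i \<noteq> b i} = {t}"
    using assms unfolding hamming_def by (auto simp: card_1_singleton_iff)
  then have d: "(a i \<noteq> b i) = (i = t)" for i by blast
  then have the: "(THE t. a t \<noteq> b t) = t" by simp
  have flip: "mcx_bits t a x = (if x = a then b else if x = b then a else x)"
  proof (cases "\<forall>i. i \<noteq> t \<longrightarrow> x i = a i")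
    case True
    show ?thesis
    proof (cases "x t = a t")
      case xt: True
      have "x = a" using True xt by (intro ext) metis
      moreover have "a(t := \<not> a t) = b" using d by (intro ext) auto
      ultimately show ?thesis by (simp add: mcx_bits_def)
    next
      case False
      have "x = b" using True False d by (intro ext) metis
      moreover have "b(t := \<not> b t) = a" using d by (intro ext) auto
      moreover have "b \<noteq> a" using d by auto
      moreover have "\<forall>i. i \<noteq> t \<longrightarrow> b i = a i" using d by auto
      ultimately show ?thesis by (simp add: mcx_bits_def)
    qed
  next
    case False
    then have "x \<noteq> a" "x \<noteq> b" using d by auto
    then show ?thesis using False by (auto simp: mcx_bits_def)
  qed
  have "(mcx t a *v ket x) $ y = ket (mcx_bits t a x) $ y" for y
  proof -
    have "(mcx t a *v ket x) $ y = (\<Sum>z\<in>UNIV. if z = x then mcx t a $ y $ z else 0)"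
      unfolding matrix_vector_mult_def ket_def axis_def vec_lambda_beta
      by (rule sum.cong) auto
    also have "\<dots> = ket (mcx_bits t a x) $ y"
      by (simp add: mcx_def ket_def axis_def)
    finally show ?thesis .
  qed
  then have "mcx t a *v ket x = ket (mcx_bits t a x)"
    by (simp add: vec_eq_iff)
  then show ?thesis by (simp only: A_SWAP_def the flip)
qed

text \<open>The head of the list is applied first, so it is the rightmost factor.\<close>

fun circuit :: "'g::finite operator list \<Rightarrow> 'g operator" where
  "circuit [] = mat 1"
| "circuit (U # Us) = circuit Us ** U"

text \<open>A path is the list of its vertices, both endpoints included.\<close>

definition walk :: "'g::finite bits list \<Rightarrow> 'g operator" where
  "walk p = circuit (map (\<lambda>k. A_SWAP (p ! k) (p ! Suc k)) [0..<length p - 1])"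

definition intermediate :: "'g bits list \<Rightarrow> 'g bits set" where
  "intermediate p = {p ! k | k. 0 < k \<and> k < length p - 1}"

definition routing_bijection ::
    "'g::finite bits set \<Rightarrow> 'g bits set \<Rightarrow> ('g bits \<Rightarrow> 'g bits) \<Rightarrow> bool" where
  "routing_bijection S2 S3 \<phi> \<longleftrightarrow>
     card S2 = card S3 \<and> bij_betw \<phi> S2 S3 \<and> (\<forall>x \<in> S2 \<inter> S3. \<phi> x = x)"

definition selected_path ::
    "'g::finite bits set \<Rightarrow> 'g bits set \<Rightarrow> 'g bits \<Rightarrow> 'g bits \<Rightarrow> 'g bits list \<Rightarrow> bool" where
  "selected_path S2 S3 a b p \<longleftrightarrow>
     length p = Suc (hamming a b) \<and> p ! 0 = a \<and> p ! hamming a b = b \<and>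
     (\<forall>k < hamming a b. hamming (p ! k) (p ! Suc k) = 1 \<and> p ! k \<notin> S2 \<inter> S3)"

text \<open>Only the ordering and the two precedence conditions on sources and targets are constraints.
  That each walk is completed before the next begins is built into \<open>A_PERMUTE\<close>, and
  the reuse of states outside \<open>S2 \<union> S3\<close> and path intersections are otherwise unrestricted.\<close>

definition admissible_schedule ::
    "'g::finite bits set \<Rightarrow> 'g bits set \<Rightarrow> ('g bits \<Rightarrow> 'g bits) \<Rightarrow>
     ('g bits \<Rightarrow> 'g bits list) \<Rightarrow> 'g bits list \<Rightarrow> bool" where
  "admissible_schedule S2 S3 \<phi> \<P> s \<longleftrightarrow>
     distinct s \<and> set s = S2 - S3 \<and>
     (\<forall>l < length s. \<forall>q < length s.
        (s ! l \<in> intermediate (\<P> (s ! q)) \<longrightarrow> l < q) \<and>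
        (\<phi> (s ! l) \<in> intermediate (\<P> (s ! q)) \<longrightarrow> q < l))"

definition A_PERMUTE :: "('g::finite bits \<Rightarrow> 'g bits list) \<Rightarrow> 'g bits list \<Rightarrow> 'g operator" where
  "A_PERMUTE \<P> s = circuit (map (\<lambda>a. walk (\<P> a)) s)"

definition permutation_unitary :: "'g::finite operator \<Rightarrow> ('g bits \<Rightarrow> 'g bits) \<Rightarrow> bool" where
  "permutation_unitary U \<sigma> \<longleftrightarrow> bij \<sigma> \<and> (\<forall>x. U *v ket x = ket (\<sigma> x))"

end

theory Submission imports Defs begin

text \<open>A walk is a product of transpositions along its path: it carries the first vertex to the last
  one and fixes every basis state off the path. The precedence conditions say exactly that a source
  \<open>a\<close> lies on no path traversed before the walk of \<open>a\<close>, and that \<open>\<phi> a\<close> lies on no path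
  traversed after it. So \<open>a\<close> stays put, is moved to \<open>\<phi> a\<close>, and then stays put again, while
  \<open>S2 \<inter> S3\<close> is met by no path at all.\<close>

text \<open>The action of \<open>walk\<close> on basis labels. The first transposition is innermost,
  just as \<open>circuit\<close> makes the first gate the rightmost factor.\<close>

fun path_perm :: "'a list \<Rightarrow> 'a \<Rightarrow> 'a" where
  "path_perm (x # y # p) = path_perm (y # p) \<circ> Transposition.transpose x y"
| "path_perm p = id"

text \<open>Each transposition hands the tracked state on to the next vertex, which is the head of
  the remaining path. The argument also covers lists with repeated vertices.\<close>

lemma path_perm_hd: "p \<noteq> [] \<Longrightarrow> path_perm p (hd p) = last p"
  by (induction p rule: path_perm.induct) auto

lemma path_perm_fixes: "x \<notin> set p \<Longrightarrow> path_perm p x = x"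
  by (induction p rule: path_perm.induct) auto

lemma fold_fixes: "(\<And>a. a \<in> set s \<Longrightarrow> f a x = x) \<Longrightarrow> fold f s x = x"
  by (induction s) auto

lemma permutation_unitary_mat_1: "permutation_unitary (mat 1) id"
  by (simp add: permutation_unitary_def)

lemma permutation_unitary_mult:
  assumes "permutation_unitary U \<sigma>" "permutation_unitary V \<tau>"
  shows "permutation_unitary (V ** U) (\<tau> \<circ> \<sigma>)"
  using assms
  by (auto simp: permutation_unitary_def bij_comp matrix_vector_mul_assoc [symmetric])

lemma permutation_unitary_A_SWAP:
  assumes "hamming a b = 1"
  shows "permutation_unitary (A_SWAP a b) (Transposition.transpose a b)"
  using A_SWAP_ket [OF assms]
  by (simp add: permutation_unitary_def Transposition.transpose_def)

text \<open>Turns the indexed product into a recursion of the same shape as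
  \<open>path_perm\<close>, so that both can be compared by one induction.\<close>

lemma walk_Cons_Cons: "walk (x # y # p) = walk (y # p) ** A_SWAP x y"
proof -
  \<comment> \<open>Index 0 is the edge from \<open>x\<close> to \<open>y\<close>; the remaining
    indices, shifted down by one, are the edges of \<open>y # p\<close>.\<close>
  have "[0..<length (x # y # p) - 1] = 0 # map Suc [0..<length (y # p) - 1]"
    by (simp add: map_Suc_upt upt_conv_Cons del: upt_Suc)
  then show ?thesis
    by (simp add: walk_def comp_def del: upt_Suc)
qed

lemma permutation_unitary_walk:
  assumes "\<And>k. Suc k < length p \<Longrightarrow> hamming (p ! k) (p ! Suc k) = 1"
  shows "permutation_unitary (walk p) (path_perm p)"
  using assms
proof (induction p rule: path_perm.induct)
  case (1 x y p)
  have "hamming ((y # p) ! k) ((y # p) ! Suc k) = 1" if "Suc k < length (y # p)" for k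
    using 1(2)[of "Suc k"] that by simp
  moreover have "hamming x y = 1"
    using 1(2)[of 0] by simp
  ultimately show ?case
    unfolding walk_Cons_Cons path_perm.simps
    by (blast intro: permutation_unitary_mult permutation_unitary_A_SWAP 1(1))
qed (simp_all add: walk_def permutation_unitary_mat_1)

text \<open>\<open>fold\<close> applies the head of the schedule first, in agreement with
  \<open>circuit\<close>, so the label permutations compose in the order of the walks.\<close>

lemma permutation_unitary_A_PERMUTE:
  assumes "\<And>a. a \<in> set s \<Longrightarrow> permutation_unitary (walk (\<P> a)) (f a)"
  shows "permutation_unitary (A_PERMUTE \<P> s) (fold f s)"
  using assms
  by (induction s) (simp_all add: A_PERMUTE_def permutation_unitary_mat_1 permutation_unitary_mult)

text \<open>The schedule restricts only intermediate vertices, whereas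
  \<open>path_perm_fixes\<close> needs a state off the whole path. This leaves just the two
  endpoints to be excluded by hand.\<close>

lemma set_subset_ends_intermediate:
  "set p \<subseteq> {hd p, last p} \<union> intermediate p"
proof
  fix x assume "x \<in> set p"
  then obtain k where k: "k < length p" "x = p ! k"
    by (auto simp: in_set_conv_nth)
  then have "p \<noteq> []" by auto
  with k consider "k = 0" | "k = length p - 1" | "0 < k" "k < length p - 1"
    by linarith
  then show "x \<in> {hd p, last p} \<union> intermediate p"
    using k \<open>p \<noteq> []\<close> by cases (auto simp: hd_conv_nth last_conv_nth intermediate_def)
qed

lemma selected_path_ends:
  assumes "selected_path S2 S3 a b p"
  shows "p \<noteq> []" "hd p = a" "last p = b"
proof -
  show "p \<noteq> []" using assms by (auto simp: selected_path_def)
  then show "hd p = a" "last p = b"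
    using assms by (simp_all add: selected_path_def hd_conv_nth last_conv_nth)
qed

lemma selected_path_permutation_unitary:
  "selected_path S2 S3 a b p \<Longrightarrow> permutation_unitary (walk p) (path_perm p)"
  by (rule permutation_unitary_walk) (simp add: selected_path_def)

text \<open>A selected path is required to avoid \<open>S2 \<inter> S3\<close> only before its last
  vertex, so the last vertex \<open>b\<close> is excluded by its own assumption.\<close>

lemma selected_path_avoids:
  assumes "selected_path S2 S3 a b p" "b \<notin> S2 \<inter> S3" "x \<in> S2 \<inter> S3"
  shows "x \<notin> set p"
  using assms by (auto simp: selected_path_def in_set_conv_nth less_Suc_eq)

lemma A_PERMUTE_routes:
  assumes \<phi>: "routing_bijection S2 S3 \<phi>"
    and paths: "\<And>a. a \<in> S2 - S3 \<Longrightarrow> selected_path S2 S3 a (\<phi> a) (\<P> a)"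
    and sched: "admissible_schedule S2 S3 \<phi> \<P> s"
    and "a \<in> S2"
  shows "fold (\<lambda>a. path_perm (\<P> a)) s a = \<phi> a"
proof -
  let ?W = "\<lambda>a. path_perm (\<P> a)"
  have dist: "distinct s" and set_s: "set s = S2 - S3"
    and source: "\<And>l q. \<lbrakk>l < length s; q < length s; s ! l \<in> intermediate (\<P> (s ! q))\<rbrakk> \<Longrightarrow> l < q"
    and target: "\<And>l q. \<lbrakk>l < length s; q < length s; \<phi> (s ! l) \<in> intermediate (\<P> (s ! q))\<rbrakk> \<Longrightarrow> q < l"
    using sched by (auto simp: admissible_schedule_def)
  have inj: "inj_on \<phi> S2" and im: "\<phi> ` S2 = S3" and fixd: "\<And>x. x \<in> S2 \<inter> S3 \<Longrightarrow> \<phi> x = x"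
    using \<phi> by (auto simp: routing_bijection_def bij_betw_def)
  \<comment> \<open>If \<open>\<phi> b\<close> were in \<open>S2\<close>, it would be a fixed point
    of \<open>\<phi>\<close>, and injectivity would give \<open>\<phi> b = b\<close>, contradicting
    that \<open>b\<close> is not in \<open>S3\<close>.\<close>
  have \<phi>_new: "\<phi> b \<in> S3 - S2" if "b \<in> S2 - S3" for b
  proof -
    have "\<phi> b \<in> S3" using that im by blast
    moreover have "\<phi> b \<notin> S2"
    proof
      assume "\<phi> b \<in> S2"
      then have "\<phi> (\<phi> b) = \<phi> b" using \<open>\<phi> b \<in> S3\<close> fixd by blast
      then have "\<phi> b = b" using inj that \<open>\<phi> b \<in> S2\<close> by (auto dest: inj_onD)
      then show False using that \<open>\<phi> b \<in> S3\<close> by simp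
    qed
    ultimately show ?thesis by blast
  qed
  have on_path: "set (\<P> b) \<subseteq> {b, \<phi> b} \<union> intermediate (\<P> b)" if "b \<in> S2 - S3" for b
    using set_subset_ends_intermediate [of "\<P> b"] selected_path_ends [OF paths [OF that]] by simp
  show ?thesis
  proof (cases "a \<in> S3")
    case True
    have "?W b a = a" if "b \<in> set s" for b
      using selected_path_avoids [OF paths, of b a] \<phi>_new [of b] that set_s True \<open>a \<in> S2\<close>
      by (auto intro!: path_perm_fixes)
    then have "fold ?W s a = a" by (rule fold_fixes)
    then show ?thesis using fixd True \<open>a \<in> S2\<close> by simp
  next
    case False
    then have a: "a \<in> S2 - S3" using \<open>a \<in> S2\<close> by simp
    then obtain l where l: "l < length s" "s ! l = a"
      using set_s by (metis in_set_conv_nth)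
    have earlier: "fold ?W (take l s) a = a"
    proof (rule fold_fixes)
      fix b assume "b \<in> set (take l s)"
      then obtain q where q: "q < l" "s ! q = b" by (auto simp: in_set_conv_nth)
      then have b: "b \<in> S2 - S3" using l set_s nth_mem [of q s] by auto
      \<comment> \<open>An intermediate occurrence of the source \<open>a\<close> would force
        \<open>l < q\<close>, against \<open>q < l\<close>. The endpoints differ from
        \<open>a\<close> since the schedule has no repetitions and \<open>\<phi> b\<close> lies
        outside \<open>S2\<close>.\<close>
      have "a \<notin> intermediate (\<P> b)" using source [of l q] q l by auto
      moreover have "a \<noteq> b" using dist q l by (auto simp: nth_eq_iff_index_eq)
      moreover have "a \<noteq> \<phi> b" using \<phi>_new [OF b] a by auto
      ultimately show "?W b a = a" using on_path [OF b] by (intro path_perm_fixes) auto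
    qed
    have now: "?W a a = \<phi> a"
      using path_perm_hd [of "\<P> a"] selected_path_ends [OF paths [OF a]] by simp
    have later: "fold ?W (drop (Suc l) s) (\<phi> a) = \<phi> a"
    proof (rule fold_fixes)
      fix b assume "b \<in> set (drop (Suc l) s)"
      then obtain k where "k < length s - Suc l" "s ! (Suc l + k) = b"
        by (auto simp: in_set_conv_nth)
      then obtain q where q: "l < q" "q < length s" "s ! q = b"
        by (intro that [of "Suc l + k"]) auto
      then have b: "b \<in> S2 - S3" using set_s nth_mem [of q s] by auto
      \<comment> \<open>The mirror image: an intermediate occurrence of the target would force
        \<open>q < l\<close>. Now injectivity of \<open>\<phi>\<close> separates
        \<open>\<phi> a\<close> from the far endpoint.\<close>
      have "\<phi> a \<notin> intermediate (\<P> b)" using target [of l q] q l by auto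
      moreover have "a \<noteq> b" using dist q l by (auto simp: nth_eq_iff_index_eq)
      then have "\<phi> a \<noteq> \<phi> b" using inj a b by (auto dest: inj_onD)
      moreover have "\<phi> a \<noteq> b" using \<phi>_new [OF a] b by auto
      ultimately show "?W b (\<phi> a) = \<phi> a" using on_path [OF b] by (intro path_perm_fixes) auto
    qed
    have "fold ?W s a = fold ?W (take l s @ s ! l # drop (Suc l) s) a"
      using id_take_nth_drop [OF l(1)] by simp
    then show ?thesis using earlier now later l by simp
  qed
qed

lemma A_PERMUTE_permutes:
  assumes "routing_bijection S2 S3 \<phi>"
    and "\<forall>a \<in> S2 - S3. selected_path S2 S3 a (\<phi> a) (\<P> a)"
    and "admissible_schedule S2 S3 \<phi> \<P> s"
  shows "\<exists>\<sigma>. permutation_unitary (A_PERMUTE \<P> s) \<sigma> \<and> (\<forall>a \<in> S2. \<sigma> a = \<phi> a) \<and>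
    \<sigma> ` S2 = S3 \<and> \<sigma> ` (UNIV - S2) = UNIV - S3"
proof -
  let ?\<sigma> = "fold (\<lambda>a. path_perm (\<P> a)) s"
  have perm: "permutation_unitary (A_PERMUTE \<P> s) ?\<sigma>"
    using assms
    by (intro permutation_unitary_A_PERMUTE)
      (auto simp: admissible_schedule_def intro: selected_path_permutation_unitary)
  have routes: "?\<sigma> a = \<phi> a" if "a \<in> S2" for a
    using A_PERMUTE_routes assms that by blast
  then have "?\<sigma> ` S2 = S3"
    using assms(1) by (simp add: routing_bijection_def bij_betw_def)
  \<comment> \<open>A bijection of the whole space commutes with complements.\<close>
  moreover have "?\<sigma> ` (UNIV - S2) = UNIV - ?\<sigma> ` S2"
    using perm bij_image_Compl_eq [of ?\<sigma> S2]
    by (simp add: permutation_unitary_def Compl_eq_Diff_UNIV)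
  ultimately show ?thesis using perm routes by blast
qed

text \<open>Supplies the nontrivial example: a single swap routes \<open>a\<close> to
  \<open>b\<close>, and must therefore move \<open>b\<close>, which lies outside the source set,
  back to \<open>a\<close>.\<close>

lemma single_swap_instance:
  fixes a b :: "'g::finite bits"
  assumes "hamming a b = 1"
  shows "routing_bijection {a} {b} (\<lambda>_. b)"
    and "selected_path {a} {b} a b [a, b]"
    and "admissible_schedule {a} {b} (\<lambda>_. b) (\<lambda>_. [a, b]) [a]"
    and "permutation_unitary (A_PERMUTE (\<lambda>_. [a, b]) [a]) (Transposition.transpose a b)"
proof -
  have "a \<noteq> b" using assms by (auto simp: hamming_def)
  then show "routing_bijection {a} {b} (\<lambda>_. b)"
    and "selected_path {a} {b} a b [a, b]"
    and "admissible_schedule {a} {b} (\<lambda>_. b) (\<lambda>_. [a, b]) [a]"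
    using assms
    by (auto simp: routing_bijection_def selected_path_def admissible_schedule_def
        intermediate_def)
  show "permutation_unitary (A_PERMUTE (\<lambda>_. [a, b]) [a]) (Transposition.transpose a b)"
    using permutation_unitary_A_SWAP [OF assms] by (simp add: A_PERMUTE_def walk_def)
qed

theorem theorem4:
  "(\<forall>(S2 :: 'g::finite bits set) S3 \<phi> \<P> s.
      routing_bijection S2 S3 \<phi> \<longrightarrow>
      (\<forall>a \<in> S2 - S3. selected_path S2 S3 a (\<phi> a) (\<P> a)) \<longrightarrow>
      admissible_schedule S2 S3 \<phi> \<P> s \<longrightarrow>
      (\<exists>\<sigma>. permutation_unitary (A_PERMUTE \<P> s) \<sigma> \<and>
           (\<forall>a \<in> S2. \<sigma> a = \<phi> a) \<and>
           \<sigma> ` S2 = S3 \<and>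
           \<sigma> ` (UNIV - S2) = UNIV - S3))
   \<and>
   (\<exists>(S2 :: 'g bits set) S3 \<phi> \<P> s \<sigma>.
      routing_bijection S2 S3 \<phi> \<and>
      (\<forall>a \<in> S2 - S3. selected_path S2 S3 a (\<phi> a) (\<P> a)) \<and>
      admissible_schedule S2 S3 \<phi> \<P> s \<and>
      permutation_unitary (A_PERMUTE \<P> s) \<sigma> \<and>
      (\<exists>x \<in> UNIV - S2. \<sigma> x \<noteq> x))"
proof (rule conjI, goal_cases)
  case 1
  show ?case using A_PERMUTE_permutes by blast
next
  case 2
  \<comment> \<open>Here \<open>undefined\<close> serves as an arbitrary qubit index, available
    because every type is inhabited; \<open>a\<close> and \<open>b\<close> differ exactly
    there.\<close>
  define a b :: "'g bits" where "a = (\<lambda>_. False)" and "b = a(undefined := True)"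
  have "{i. a i \<noteq> b i} = {undefined}" by (auto simp: a_def b_def)
  then have h: "hamming a b = 1" by (simp add: hamming_def)
  then have "b \<in> UNIV - {a}" "Transposition.transpose a b b \<noteq> b" by (auto simp: hamming_def)
  moreover have "\<forall>x \<in> {a} - {b}. selected_path {a} {b} x b [a, b]"
    using single_swap_instance(2) [OF h] by simp
  ultimately show ?case
    using single_swap_instance(1,3,4) [OF h]
    by (intro exI [of _ "{a}"] exI [of _ "{b}"] exI [of _ "\<lambda>_. b"] exI [of _ "\<lambda>_. [a, b]"]
        exI [of _ "[a]"] exI [of _ "Transposition.transpose a b"]) blast
qed

end
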